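(* Let $n$ be a positive integer, and set $a=2^{n+1}+1$ and $f=x^a+y^a+z^a$. For all prime numbers $p$ such that $p\equiv 2\pmod a$, the principal ideal $(f)$, considered as an ideal in the formal power series ring $\mathbf{F}_p[[x,y,z]]$, has an $F$-jumping number in the interval $\left(1-\frac{1}{p^n},1-\frac{1}{p^{n+1}}\right]$.
   Context: Let $R$ be a regular domain of characteristic $p>0$ that is $F$-finite (the Frobenius endomorphism is finite). For an ideal $J$ put $J^{[p^e]}=(h^{p^e}\mid h\in J)$, and for an ideal $\mathfrak{b}$ let $\mathfrak{b}^{[1/p^e]}$ be the unique smallest ideal $J$ with $\mathfrak{b}\subseteq J^{[p^e]}$. For a nonzero ideal $\mathfrak{b}$ and $\lambda\in\mathbf{R}_{\geq 0}$, the test ideal is $\tau(\mathfrak{b}^\lambda)=(\mathfrak{b}^{\lceil\lambda p^e\rceil})^{[1/p^e]}$ for $e\gg 0$ (these ideals form an increasing chain in $e$, which stabilizes). A number $\lambda>0$ is an $F$-jumping number of $\mathfrak{b}$ if $\tau(\mathfrak{b}^\lambda)\neq\tau(\mathfrak{b}^\mu)$ for every $0\le\mu<\lambda$. *)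

theory Defs
  imports
    "HOL-Computational_Algebra.Formal_Power_Series"
    "HOL-Number_Theory.Cong"
    "Berlekamp_Zassenhaus.Finite_Field"
    Complex_Main
begin

section \<open>Ideals of a commutative ring\<close>

text \<open>Ideals are the submodules of the ring viewed as a module over itself.\<close>

lemma module_times: "Modules.module ((*) :: 'a::comm_ring_1 \<Rightarrow> 'a \<Rightarrow> 'a)"
  by unfold_locales (simp_all only: distrib_left distrib_right mult.assoc mult_1_left)

definition is_ideal :: "'a::comm_ring_1 set \<Rightarrow> bool"
  where "is_ideal J \<longleftrightarrow> Modules.module.subspace (*) J"

definition ideal_gen :: "'a::comm_ring_1 set \<Rightarrow> 'a set"
  where "ideal_gen S = Modules.module.span (*) S"

lemma is_ideal_iff:
  "is_ideal J \<longleftrightarrow> 0 \<in> J \<and> (\<forall>x\<in>J. \<forall>y\<in>J. x + y \<in> J) \<and> (\<forall>r. \<forall>x\<in>J. r * x \<in> J)"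
  by (simp add: is_ideal_def Modules.module.subspace_def[OF module_times])

lemma ideal_gen_principal: "ideal_gen {f} = {r * f | r. True}"
  by (auto simp: ideal_gen_def Modules.module.span_singleton[OF module_times])

primrec ideal_power :: "'a::comm_ring_1 set \<Rightarrow> nat \<Rightarrow> 'a set"
  where
    "ideal_power b 0 = UNIV"
  | "ideal_power b (Suc m) = ideal_gen {x * y | x y. x \<in> b \<and> y \<in> ideal_power b m}"


section \<open>Test ideals and F-jumping numbers\<close>

text \<open>
  The characteristic \<open>p\<close> of the ambient ring \<open>'a\<close> is \<open>CHAR('a)\<close>.  In the following definitions,
  \<open>frob_power J e\<close> is $J^{[p^e]}$ and \<open>frob_root b e\<close> is $b^{[1/p^e]}$.  As sets are ordered by
  inclusion, \<open>LEAST\<close> denotes the smallest ideal with the given property.  This ideal exists and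
  the chain defining the test ideal stabilizes for nonzero \<open>b\<close> in an F-finite regular domain;
  the definitions are meant for such rings only.
\<close>

definition frob_power :: "'a::comm_ring_1 set \<Rightarrow> nat \<Rightarrow> 'a set"
  where "frob_power J e = ideal_gen ((\<lambda>h. h ^ (CHAR('a) ^ e)) ` J)"

definition frob_root :: "'a::comm_ring_1 set \<Rightarrow> nat \<Rightarrow> 'a set"
  where "frob_root b e = (LEAST J. is_ideal J \<and> b \<subseteq> frob_power J e)"

definition test_ideal :: "'a::comm_ring_1 set \<Rightarrow> real \<Rightarrow> 'a set"
  where "test_ideal b l =
    (THE J. \<forall>\<^sub>F e in sequentially. frob_root (ideal_power b (nat \<lceil>l * real (CHAR('a) ^ e)\<rceil>)) e = J)"

definition F_jumping_number :: "'a::comm_ring_1 set \<Rightarrow> real \<Rightarrow> bool"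
  where "F_jumping_number b l \<longleftrightarrow>
    l > 0 \<and> (\<forall>m. 0 \<le> m \<and> m < l \<longrightarrow> test_ideal b l \<noteq> test_ideal b m)"


section \<open>Power series in three variables\<close>

text \<open>
  The ring $k[[x,y,z]]$ is represented as $k[[x]][[y]][[z]]$.  The lemmas after the definitions show
  that this is the usual ring of power series in three variables: a series amounts to an arbitrary
  family of coefficients indexed by triples of exponents, with the convolution product.
\<close>

type_synonym 'k fps3 = "'k fps fps fps"

definition var_x :: "'k::comm_ring_1 fps3" where "var_x = fps_const (fps_const fps_X)"
definition var_y :: "'k::comm_ring_1 fps3" where "var_y = fps_const fps_X"
definition var_z :: "'k::comm_ring_1 fps3" where "var_z = fps_X"

definition coeff3 :: "'k::comm_ring_1 fps3 \<Rightarrow> nat \<times> nat \<times> nat \<Rightarrow> 'k"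
  where "coeff3 F = (\<lambda>(i, j, k). fps_nth (fps_nth (fps_nth F k) j) i)"

lemma bij_coeff3: "bij (coeff3 :: 'k::comm_ring_1 fps3 \<Rightarrow> _)"
proof (rule bijI)
  show "inj (coeff3 :: 'k fps3 \<Rightarrow> _)"
    by (rule injI) (auto simp: coeff3_def fun_eq_iff fps_eq_iff)
  have "coeff3 (Abs_fps (\<lambda>k. Abs_fps (\<lambda>j. Abs_fps (\<lambda>i. c (i, j, k))))) = c"
    for c :: "nat \<times> nat \<times> nat \<Rightarrow> 'k"
    by (auto simp: coeff3_def fun_eq_iff)
  then show "surj (coeff3 :: 'k fps3 \<Rightarrow> _)"
    by (rule surjI)
qed

lemma coeff3_add: "coeff3 (F + G) u = coeff3 F u + coeff3 G u"
  by (cases u) (simp add: coeff3_def)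

lemma coeff3_mult:
  "coeff3 (F * G) (i, j, k) =
     (\<Sum>k'\<le>k. \<Sum>j'\<le>j. \<Sum>i'\<le>i. coeff3 F (i', j', k') * coeff3 G (i - i', j - j', k - k'))"
  by (simp add: coeff3_def fps_mult_nth fps_sum_nth atLeast0AtMost)

lemma coeff3_monomial:
  "coeff3 (var_x ^ i * var_y ^ j * var_z ^ k) u = (if u = (i, j, k) then 1 else 0)"
proof -
  have "var_x ^ i * var_y ^ j * var_z ^ k =
      (fps_const (fps_const (fps_X ^ i) * fps_X ^ j) * fps_X ^ k :: 'a fps3)"
    by (simp only: var_x_def var_y_def var_z_def fps_const_power fps_const_mult)
  moreover have "fps_nth (fps_nth (fps_nth \<dots> k') j') i' =
      (if k' = k \<and> j' = j \<and> i' = i then 1 else 0)" for i' j' k'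
    by (simp only: fps_mult_left_const_nth fps_X_power_nth) simp
  ultimately show ?thesis
    by (cases u) (auto simp only: coeff3_def prod.case prod.inject split: if_splits)
qed

lemma CHAR_fps3: "CHAR('p::prime_card mod_ring fps3) = CARD('p)"
  by simp

end

theory Submission
  imports Defs
begin

text \<open>
  Let $q = p^e$. As $a$ is prime to $p$, the exponents of distinct terms of $f^{q-1}$ are
  incongruent modulo $q$, so that $(f^{q-1})^{[1/q]}$ is generated by the monomials with exponents
  $\lfloor ai/q \rfloor, \lfloor aj/q \rfloor, \lfloor ak/q \rfloor$, where $i+j+k=q-1$ and
  the trinomial coefficient is nonzero modulo $p$.
  For $e = n$ the choice $i = j = (p^n - 2^n)/a$ gives $z^{a-3}$; adding the
  base-$p$ digits of $i$ and $j$ produces no carry because they are smaller than $p/2$.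
  For $e = n + 1$ we have $p^{n+1} \equiv -1$ modulo $a$, and a count of
  exponents shows $f^{q-1} \in (x, y, z^{a-2})^{[q]}$. So the test ideals at $1 - 1/p^n$ and
  $1 - 1/p^{n+1}$ differ, and the supremum of the exponents whose test ideal contains $z^{a-3}$ is
  a jumping number, by right continuity.
  The chains defining the test ideals stabilize at exponents up to $1 - 1/p^{n+1}$ because only
  finitely many ideals contain $(x^a, y^a, z^a)$.
\<close>

section \<open>Ideals and Frobenius roots\<close>

lemma ideal_gen_is_ideal: "is_ideal (ideal_gen S)"
  by (simp add: is_ideal_def ideal_gen_def Modules.module.subspace_span[OF module_times])

lemma ideal_gen_superset: "S \<subseteq> ideal_gen S"
  by (simp add: ideal_gen_def Modules.module.span_superset[OF module_times])

lemma ideal_gen_subset_iff: "is_ideal J \<Longrightarrow> ideal_gen S \<subseteq> J \<longleftrightarrow> S \<subseteq> J"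
  unfolding is_ideal_def ideal_gen_def
  by (meson Modules.module.span_minimal Modules.module.span_superset module_times subset_trans)

lemma is_idealD:
  assumes "is_ideal J"
  shows is_ideal_zero: "0 \<in> J"
    and is_ideal_add: "x \<in> J \<Longrightarrow> y \<in> J \<Longrightarrow> x + y \<in> J"
    and is_ideal_mult_left: "x \<in> J \<Longrightarrow> r * x \<in> J"
    and is_ideal_mult_right: "x \<in> J \<Longrightarrow> x * r \<in> J"
  using assms by (simp_all add: is_ideal_iff mult.commute[of x r])

lemma is_ideal_sum: "is_ideal J \<Longrightarrow> (\<And>i. i \<in> I \<Longrightarrow> g i \<in> J) \<Longrightarrow> sum g I \<in> J"
  by (induction I rule: infinite_finite_induct) (simp_all add: is_ideal_zero is_ideal_add)

lemma is_ideal_diff: "is_ideal J \<Longrightarrow> x \<in> J \<Longrightarrow> y \<in> J \<Longrightarrow> x - y \<in> J"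
  using is_ideal_add[of J x "-1 * y"] is_ideal_mult_left[of J y "-1"] by simp

lemma mem_ideal_gen: "g \<in> S \<Longrightarrow> g \<in> ideal_gen S"
  using ideal_gen_superset by blast

lemma ideal_power_principal: "ideal_power (ideal_gen {g}) m = ideal_gen {g ^ m}"
proof (induction m)
  case 0
  show ?case by (auto simp: ideal_gen_principal)
next
  case (Suc m)
  have "{x * y |x y. x \<in> ideal_gen {g} \<and> y \<in> ideal_gen {g ^ m}} = ideal_gen {g ^ Suc m}"
  proof safe
    fix x y assume "x \<in> ideal_gen {g}" "y \<in> ideal_gen {g ^ m}"
    then obtain r s where "x = r * g" "y = s * g ^ m" by (auto simp: ideal_gen_principal)
    then have "x * y = (r * s) * g ^ Suc m" by (simp add: algebra_simps)
    then show "x * y \<in> ideal_gen {g ^ Suc m}" by (auto simp: ideal_gen_principal)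
  next
    fix x assume "x \<in> ideal_gen {g ^ Suc m}"
    then obtain r where "x = (r * g) * g ^ m" by (auto simp: ideal_gen_principal mult.assoc)
    moreover have "r * g \<in> ideal_gen {g}" by (auto simp: ideal_gen_principal)
    moreover have "g ^ m \<in> ideal_gen {g ^ m}" by (simp add: mem_ideal_gen)
    ultimately show "\<exists>y z. x = y * z \<and> y \<in> ideal_gen {g} \<and> z \<in> ideal_gen {g ^ m}"
      by blast
  qed
  moreover have "ideal_gen (ideal_gen {g ^ Suc m}) = ideal_gen {g ^ Suc m}"
    by (simp add: ideal_gen_def Modules.module.span_span[OF module_times])
  ultimately show ?case by (simp add: Suc)
qed

text \<open>For q = p^e these are the p^(-e)-linear maps. They undo q-th powers, and so turn
  membership in a bracket power into membership in the ideal itself.\<close>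

definition cartier :: "nat \<Rightarrow> ('a::comm_ring_1 \<Rightarrow> 'a) \<Rightarrow> bool"
  where "cartier q \<theta> \<longleftrightarrow> (\<forall>s t. \<theta> (s + t) = \<theta> s + \<theta> t) \<and> (\<forall>s t. \<theta> (s ^ q * t) = s * \<theta> t)"

lemma cartierD:
  assumes "cartier q \<theta>"
  shows cartier_add: "\<theta> (s + t) = \<theta> s + \<theta> t"
    and cartier_mult: "\<theta> (s ^ q * t) = s * \<theta> t"
  using assms by (auto simp: cartier_def)

lemma cartier_zero: "cartier q \<theta> \<Longrightarrow> \<theta> 0 = 0"
  using cartier_add[of q \<theta> 0 0] by simp

lemma cartier_sum: "cartier q \<theta> \<Longrightarrow> \<theta> (sum g I) = (\<Sum>i\<in>I. \<theta> (g i))"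
  by (induction I rule: infinite_finite_induct) (simp_all add: cartier_zero cartier_add)

lemma cartier_of_nat_mult: "cartier q \<theta> \<Longrightarrow> \<theta> (of_nat c * t) = of_nat c * \<theta> t"
  by (induction c) (simp_all add: cartier_zero cartier_add algebra_simps)

text \<open>A finite dual basis, as in the dual basis lemma, for R as a module over itself through
  the q-th power map. In this form F-finiteness and flatness of Frobenius enter.\<close>

definition frob_basis :: "nat \<Rightarrow> 'i set \<Rightarrow> ('i \<Rightarrow> 'a::comm_ring_1) \<Rightarrow> ('i \<Rightarrow> 'a \<Rightarrow> 'a) \<Rightarrow> bool"
  where "frob_basis q I b \<theta> \<longleftrightarrow>
    finite I \<and> (\<forall>i\<in>I. cartier q (\<theta> i)) \<and> (\<forall>s. (\<Sum>i\<in>I. b i * \<theta> i s ^ q) = s)"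

section \<open>Bracket powers and Frobenius roots\<close>

lemma frob_power_is_ideal: "is_ideal (frob_power J e)"
  by (simp add: frob_power_def ideal_gen_is_ideal)

lemma mem_frob_power: "h \<in> J \<Longrightarrow> h ^ (CHAR('a) ^ e) \<in> frob_power J e" for h :: "'a::comm_ring_1"
  by (auto simp: frob_power_def intro: mem_ideal_gen)

lemma frob_power_subset_iff:
  fixes J K :: "'a::comm_ring_1 set"
  shows "is_ideal K \<Longrightarrow> frob_power J e \<subseteq> K \<longleftrightarrow> (\<forall>h\<in>J. h ^ (CHAR('a) ^ e) \<in> K)"
  by (auto simp: frob_power_def ideal_gen_subset_iff)

lemma frob_power_mono: "J \<subseteq> K \<Longrightarrow> frob_power J e \<subseteq> frob_power K e"
  by (auto simp: frob_power_subset_iff frob_power_is_ideal intro: mem_frob_power)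

text \<open>With q = p^e, the generators h^q satisfy \<theta> (c * h^q) = h * \<theta> c, which lies
  in J.\<close>

lemma cartier_frob_power:
  fixes g :: "'a::comm_ring_1"
  assumes "cartier (CHAR('a) ^ e) \<theta>" "is_ideal J" "g \<in> frob_power J e"
  shows "\<theta> g \<in> J"
proof -
  \<comment> \<open>The preimage of J under \<theta> need not absorb multiplication; quantifying
    over all multiples makes \<open>?K\<close> an ideal, and c = 1 recovers the claim.\<close>
  let ?K = "{g. \<forall>c. \<theta> (c * g) \<in> J}"
  have "is_ideal ?K"
    using assms by (auto simp: is_ideal_iff cartier_zero cartier_add distrib_left simp flip: mult.assoc)
  moreover have "h ^ (CHAR('a) ^ e) \<in> ?K" if "h \<in> J" for h
  proof -
    have "\<theta> (c * h ^ (CHAR('a) ^ e)) = h * \<theta> c" for c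
      using assms(1) by (metis cartier_mult mult.commute)
    with assms(2) that show ?thesis by (simp add: is_ideal_mult_right)
  qed
  ultimately have "frob_power J e \<subseteq> ?K"
    by (simp add: frob_power_subset_iff)
  with assms(3) show ?thesis
    by (metis (mono_tags, lifting) mem_Collect_eq mult_1 subset_iff)
qed

text \<open>In characteristic p taking p^k-th powers is additive, so the elements sent into an ideal
  form an ideal and only generators need testing.\<close>

lemma frob_power_power:
  fixes g :: "'a::comm_ring_1"
  assumes "prime CHAR('a)" "g \<in> frob_power J e"
  shows "g ^ (CHAR('a) ^ k) \<in> frob_power J (e + k)"
proof -
  let ?K = "{g. g ^ (CHAR('a) ^ k) \<in> frob_power J (e + k)}"
  have "is_ideal ?K"
    using assms frob_power_is_ideal[of J "e + k"] unfolding is_ideal_iff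
    by (auto simp: freshmans_dream' power_mult_distrib zero_power prime_gt_0_nat)
  moreover have "h ^ (CHAR('a) ^ e) \<in> ?K" if "h \<in> J" for h
    using mem_frob_power[OF that, of "e + k"] by (simp add: power_add power_mult)
  ultimately have "frob_power J e \<subseteq> ?K"
    by (simp add: frob_power_subset_iff)
  with assms(2) show ?thesis by blast
qed

lemma frob_power_add_subset:
  "frob_power J (e + k) \<subseteq> frob_power (frob_power J e) k"
  for J :: "'a::comm_ring_1 set"
  by (auto simp: frob_power_subset_iff frob_power_is_ideal power_add power_mult
      intro: mem_frob_power)

text \<open>Applying \<theta> to g^(p^k) * c returns g. The case c = 1 cancels Frobenius, as
  flatness would; the case c = f is the source of right continuity.\<close>

lemma mem_frob_power_cancel:
  fixes g c :: "'a::comm_ring_1"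
  assumes "cartier (CHAR('a) ^ k) \<theta>" "\<theta> c = 1" "g ^ (CHAR('a) ^ k) * c \<in> frob_power J (e + k)"
  shows "g \<in> frob_power J e"
  using cartier_frob_power[OF assms(1) frob_power_is_ideal
      subsetD[OF frob_power_add_subset assms(3)]] assms(1,2)
  by (simp add: cartier_mult)

text \<open>The root is generated by the coordinates \<theta> i g of the elements g of B: expanding
  g in the dual basis puts B into the bracket power, and Cartier maps send the bracket power of any
  competing ideal K into K. So \<open>LEAST\<close> is well defined here.\<close>

lemma frob_root_galois:
  fixes B J :: "'a::comm_ring_1 set" and \<theta> :: "'i \<Rightarrow> 'a \<Rightarrow> 'a"
  assumes basis: "frob_basis (CHAR('a) ^ e) I b \<theta>"
  shows is_ideal_frob_root: "is_ideal (frob_root B e)"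
    and frob_root_subset_iff: "is_ideal J \<Longrightarrow> frob_root B e \<subseteq> J \<longleftrightarrow> B \<subseteq> frob_power J e"
proof -
  define R where "R = ideal_gen (\<Union>i\<in>I. \<theta> i ` B)"
  have "B \<subseteq> frob_power R e"
  proof
    fix g :: 'a assume "g \<in> B"
    have "(\<Sum>i\<in>I. b i * \<theta> i g ^ (CHAR('a) ^ e)) \<in> frob_power R e"
    proof (intro is_ideal_sum frob_power_is_ideal is_ideal_mult_left mem_frob_power)
      show "\<theta> i g \<in> R" if "i \<in> I" for i
        unfolding R_def using that \<open>g \<in> B\<close> by (blast intro: mem_ideal_gen)
    qed
    then show "g \<in> frob_power R e"
      using basis by (simp add: frob_basis_def)
  qed
  moreover have least: "R \<subseteq> K" if "is_ideal K" "B \<subseteq> frob_power K e" for K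
    using that basis unfolding R_def frob_basis_def
    by (auto simp: ideal_gen_subset_iff intro: cartier_frob_power)
  ultimately have "frob_root B e = R"
    unfolding frob_root_def by (intro Least_equality) (auto simp: R_def ideal_gen_is_ideal)
  with \<open>B \<subseteq> frob_power R e\<close> least show "is_ideal (frob_root B e)"
    "is_ideal J \<Longrightarrow> frob_root B e \<subseteq> J \<longleftrightarrow> B \<subseteq> frob_power J e"
    using frob_power_mono[of R J e] by (auto simp: R_def ideal_gen_is_ideal)
qed

section \<open>Cartier maps on power series\<close>

text \<open>The q-th power is additive on finite sums, so F is cut after degree n; the tail
  contributes to F^q only from degree (n + 1) * q > n on.\<close>

lemma fps_nth_power_CHAR:
  fixes F :: "'a::comm_ring_1 fps"
  assumes "prime CHAR('a)" and q: "q = CHAR('a) ^ e"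
  shows "fps_nth (F ^ q) n = (if q dvd n then fps_nth F (n div q) ^ q else 0)"
proof -
  have "q > 0" using assms by (simp add: prime_gt_0_nat)
  have dream: "(G + H) ^ q = G ^ q + H ^ q" for G H :: "'a fps"
    by (rule freshmans_dream') (use assms in auto)
  have dream_sum: "sum g I ^ q = (\<Sum>i\<in>I. g i ^ q)" for g :: "nat \<Rightarrow> 'a fps" and I
    by (rule freshmans_dream_sum') (use assms in auto)
  define G where "G = (\<Sum>i\<le>n. fps_const (fps_nth F i) * fps_X ^ i)"
  define H where "H = fps_shift (Suc n) F"
  have "F = G + H * fps_X ^ Suc n"
  proof (rule fps_ext)
    fix m
    have "fps_nth G m = (if m \<le> n then fps_nth F m else 0)"
      by (simp add: G_def fps_sum_nth fps_X_power_nth if_distrib cong: if_cong)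
    then show "fps_nth F m = fps_nth (G + H * fps_X ^ Suc n) m"
      by (simp add: H_def fps_X_power_mult_right_nth del: power_Suc)
  qed
  then have "F ^ q = G ^ q + H ^ q * fps_X ^ (Suc n * q)"
    by (simp only: dream power_mult_distrib power_mult)
  moreover have "n < Suc n * q"
    using \<open>q > 0\<close> mult_le_mono2[of 1 q "Suc n"] by simp
  ultimately have "fps_nth (F ^ q) n = fps_nth (G ^ q) n"
    by (simp add: fps_X_power_mult_right_nth del: mult_Suc)
  also have "G ^ q = (\<Sum>i\<le>n. fps_const (fps_nth F i ^ q) * fps_X ^ (i * q))"
    by (simp add: G_def dream_sum power_mult_distrib power_mult fps_const_power)
  also have "fps_nth \<dots> n = (\<Sum>i\<le>n. if n = i * q then fps_nth F i ^ q else 0)"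
    by (simp add: fps_sum_nth fps_X_power_nth if_distrib cong: if_cong)
  also have "\<dots> = (if q dvd n then fps_nth F (n div q) ^ q else 0)"
  proof (cases "q dvd n")
    case True
    then have "n = i * q \<longleftrightarrow> i = n div q" for i using \<open>q > 0\<close> by auto
    then show ?thesis using True by simp
  next
    case False
    then have "n \<noteq> i * q" for i by auto
    then show ?thesis using False by simp
  qed
  finally show ?thesis .
qed

text \<open>The coordinate function of X^r when series are expanded in 1, X, ..., X^(q-1) over the
  series in X^q; \<theta> plays the same role for the coefficients.\<close>

definition cartier_fps :: "nat \<Rightarrow> nat \<Rightarrow> ('a::zero \<Rightarrow> 'a) \<Rightarrow> 'a fps \<Rightarrow> 'a fps"
  where "cartier_fps q r \<theta> F = Abs_fps (\<lambda>n. \<theta> (fps_nth F (q * n + r)))"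

lemma cartier_cartier_fps:
  fixes \<theta> :: "'a::comm_ring_1 \<Rightarrow> 'a"
  assumes "prime CHAR('a)" "q = CHAR('a) ^ e" "r < q" "cartier q \<theta>"
  shows "cartier q (cartier_fps q r \<theta>)"
  unfolding cartier_def
proof (intro conjI allI)
  fix S T :: "'a fps"
  show "cartier_fps q r \<theta> (S + T) = cartier_fps q r \<theta> S + cartier_fps q r \<theta> T"
    using assms(4) by (simp add: cartier_fps_def fps_eq_iff cartier_add)
  show "cartier_fps q r \<theta> (S ^ q * T) = S * cartier_fps q r \<theta> T"
  proof (rule fps_ext)
    fix n
    have "fps_nth (S ^ q * T) (q * n + r) =
        (\<Sum>m=0..q * n + r. fps_nth (S ^ q) m * fps_nth T (q * n + r - m))"
      by (simp add: fps_mult_nth)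
    \<comment> \<open>Only exponents q * k occur in S^q, and r < q makes q * k \<le> q * n + r
      equivalent to k \<le> n.\<close>
    also have "\<dots> = (\<Sum>m\<in>(*) q ` {0..n}. fps_nth (S ^ q) m * fps_nth T (q * n + r - m))"
    proof (rule sum.mono_neutral_right)
      show "(*) q ` {0..n} \<subseteq> {0..q * n + r}" by (auto intro!: trans_le_add1 mult_le_mono2)
      show "\<forall>m\<in>{0..q * n + r} - (*) q ` {0..n}. fps_nth (S ^ q) m * fps_nth T (q * n + r - m) = 0"
      proof
        fix m assume m: "m \<in> {0..q * n + r} - (*) q ` {0..n}"
        have "\<not> q dvd m"
        proof
          assume "q dvd m"
          then obtain k where k: "m = q * k" by auto
          then have "q * k < q * Suc n" using m assms(3) by simp
          then have "k \<le> n" by (simp only: mult_less_cancel1 less_Suc_eq_le)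
          with k m show False by auto
        qed
        then show "fps_nth (S ^ q) m * fps_nth T (q * n + r - m) = 0"
          by (simp add: fps_nth_power_CHAR[OF assms(1,2)])
      qed
    qed simp
    also have "\<dots> = (\<Sum>m=0..n. fps_nth S m ^ q * fps_nth T (q * (n - m) + r))"
    proof (subst sum.reindex)
      show "inj_on ((*) q) {0..n}" using assms(3) by (auto intro: inj_onI)
      show "sum ((\<lambda>m. fps_nth (S ^ q) m * fps_nth T (q * n + r - m)) \<circ> (*) q) {0..n} =
          (\<Sum>m=0..n. fps_nth S m ^ q * fps_nth T (q * (n - m) + r))"
        using assms(3)
        by (intro sum.cong) (auto simp: fps_nth_power_CHAR[OF assms(1,2)] diff_mult_distrib2)
    qed
    finally have "fps_nth (cartier_fps q r \<theta> (S ^ q * T)) n =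
        \<theta> (\<Sum>m=0..n. fps_nth S m ^ q * fps_nth T (q * (n - m) + r))"
      by (simp only: cartier_fps_def fps_nth_Abs_fps)
    then show "fps_nth (cartier_fps q r \<theta> (S ^ q * T)) n = fps_nth (S * cartier_fps q r \<theta> T) n"
      using assms(4)
      by (simp add: cartier_fps_def fps_mult_nth[of S] cartier_sum cartier_mult)
  qed
qed

lemma cartier_fps_monomial:
  assumes "r < q" "\<theta> 0 = 0"
  shows "cartier_fps q r \<theta> (fps_const c * fps_X ^ v) =
    (if v mod q = r then fps_const (\<theta> c) * fps_X ^ (v div q) else 0)"
proof (rule fps_ext)
  fix n
  have "q * n + r = v \<longleftrightarrow> v mod q = r \<and> n = v div q"
    using assms(1) by auto
  then show "fps_nth (cartier_fps q r \<theta> (fps_const c * fps_X ^ v)) n =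
      fps_nth (if v mod q = r then fps_const (\<theta> c) * fps_X ^ (v div q) else 0) n"
    using assms(2) by (auto simp: cartier_fps_def fps_X_power_nth)
qed

text \<open>Sorting exponents by their residue r modulo q writes a series as a sum of X^r times
  series in X^q, whose coefficients are expanded in the given basis. Each use adds one
  variable.\<close>

lemma frob_basis_fps:
  fixes \<theta> :: "'i \<Rightarrow> 'a::comm_ring_1 \<Rightarrow> 'a"
  assumes "prime CHAR('a)" "q = CHAR('a) ^ e" "frob_basis q I b \<theta>"
  shows "frob_basis q ({..<q} \<times> I) (\<lambda>(r, i). fps_const (b i) * fps_X ^ r)
    (\<lambda>(r, i). cartier_fps q r (\<theta> i))"
  unfolding frob_basis_def
proof (intro conjI allI)
  have "q > 0" using assms(1,2) by (simp add: prime_gt_0_nat)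
  show "finite ({..<q} \<times> I)" using assms(3) by (simp add: frob_basis_def)
  show "\<forall>x\<in>{..<q} \<times> I. cartier q (case x of (r, i) \<Rightarrow> cartier_fps q r (\<theta> i))"
    using assms by (auto simp: frob_basis_def intro!: cartier_cartier_fps)
  fix S :: "'a fps"
  have "(\<Sum>(r, i)\<in>{..<q} \<times> I. fps_const (b i) * fps_X ^ r * cartier_fps q r (\<theta> i) S ^ q) = S"
  proof (rule fps_ext)
    fix n
    have coeff: "fps_nth (fps_const (b i) * fps_X ^ r * cartier_fps q r (\<theta> i) S ^ q) n =
        (if r = n mod q then b i * \<theta> i (fps_nth S n) ^ q else 0)" if "r < q" for r i
    proof -
      have "r \<le> n \<and> q dvd n - r \<longleftrightarrow> r = n mod q"
        using that by (metis mod_eq_dvd_iff_nat mod_less mod_less_eq_dividend)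
      moreover have "q * ((n - n mod q) div q) + n mod q = n"
        by (simp add: minus_mod_eq_mult_div)
      ultimately show ?thesis
        by (auto simp: mult.assoc fps_X_power_mult_nth fps_nth_power_CHAR[OF assms(1,2)] cartier_fps_def)
    qed
    have "fps_nth (\<Sum>(r, i)\<in>{..<q} \<times> I. fps_const (b i) * fps_X ^ r * cartier_fps q r (\<theta> i) S ^ q) n
      = (\<Sum>r<q. \<Sum>i\<in>I. if r = n mod q then b i * \<theta> i (fps_nth S n) ^ q else 0)"
      by (simp add: fps_sum_nth sum.cartesian_product[symmetric] coeff)
    also have "\<dots> = (\<Sum>r<q. if r = n mod q then \<Sum>i\<in>I. b i * \<theta> i (fps_nth S n) ^ q else 0)"
      by (intro sum.cong) auto
    also have "\<dots> = fps_nth S n"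
      using assms(3) \<open>q > 0\<close> by (simp add: frob_basis_def)
    finally show "fps_nth (\<Sum>(r, i)\<in>{..<q} \<times> I. fps_const (b i) * fps_X ^ r * cartier_fps q r (\<theta> i) S ^ q) n
      = fps_nth S n" .
  qed
  then show "(\<Sum>x\<in>{..<q} \<times> I. (case x of (r, i) \<Rightarrow> fps_const (b i) * fps_X ^ r) *
      (case x of (r, i) \<Rightarrow> cartier_fps q r (\<theta> i)) S ^ q) = S"
    by (simp add: case_prod_beta')
qed

section \<open>Three variables over a prime field\<close>

text \<open>Fermat's little theorem; it makes the identity a Cartier map on the prime field.\<close>

lemma mod_ring_power_CARD: "x ^ (CARD('p) ^ e) = x" for x :: "'p::prime_card mod_ring"
proof (induction e)
  case (Suc e)
  have "x ^ CARD('p) = x"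
  proof -
    obtain i :: nat where "x = of_nat i" using surj_of_nat_mod_ring by blast
    moreover have "[i ^ CARD('p) = i] (mod CARD('p))"
    proof (cases "CARD('p) dvd i")
      case True
      then have "[i = 0] (mod CARD('p))" by (simp add: cong_0_iff)
      moreover from True have "CARD('p) dvd i ^ CARD('p)"
        by (meson dvd_power dvd_trans zero_less_card_finite)
      then have "[i ^ CARD('p) = 0] (mod CARD('p))" by (simp add: cong_0_iff)
      ultimately show ?thesis by (metis cong_sym cong_trans)
    next
      case False
      have "[i ^ (CARD('p) - 1) * i = 1 * i] (mod CARD('p))"
        by (intro cong_mult cong_refl fermat_theorem prime_card False)
      then show ?thesis by (simp flip: power_Suc2)
    qed
    ultimately show ?thesis
      by (metis of_nat_eq_iff_cong_CHAR of_nat_power semiring_char_mod_ring)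
  qed
  with Suc show ?case by (simp add: power_mult)
qed simp

lemma cartier_id_mod_ring: "cartier (CARD('p) ^ e) (id :: 'p::prime_card mod_ring \<Rightarrow> _)"
  by (simp add: cartier_def mod_ring_power_CARD)

text \<open>The coordinate function of x^r y^s z^t; z is treated outermost because the ring is
  k[[x]][[y]][[z]].\<close>

definition cartier3 :: "nat \<Rightarrow> nat \<Rightarrow> nat \<Rightarrow> nat \<Rightarrow> 'k::comm_ring_1 fps3 \<Rightarrow> 'k fps3"
  where "cartier3 q r s t = cartier_fps q t (cartier_fps q s (cartier_fps q r id))"

lemma prime_CHAR_fps3:
  "prime CHAR('p::prime_card mod_ring)"
  "prime CHAR('p::prime_card mod_ring fps)"
  "prime CHAR('p::prime_card mod_ring fps fps)"
  "prime CHAR('p::prime_card mod_ring fps3)"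
  by (simp_all add: prime_card)

lemma cartier_cartier3:
  assumes "q = CARD('p) ^ e" "r < q" "s < q" "t < q"
  shows "cartier q (cartier3 q r s t :: 'p::prime_card mod_ring fps3 \<Rightarrow> _)"
  unfolding cartier3_def
  using assms cartier_id_mod_ring[where ?'p='p and e=e]
  by (auto intro!: cartier_cartier_fps[where e=e] simp: prime_card)

lemma cartier3_monomial:
  assumes "r < q" "s < q" "t < q"
  shows "cartier3 q r s t (var_x ^ i * var_y ^ j * var_z ^ k :: 'k::comm_ring_1 fps3) =
    (if i mod q = r \<and> j mod q = s \<and> k mod q = t
     then var_x ^ (i div q) * var_y ^ (j div q) * var_z ^ (k div q) else 0)"
proof -
  have mono: "var_x ^ i * var_y ^ j * var_z ^ k =
      fps_const (fps_const (fps_X ^ i) * fps_X ^ j) * (fps_X ^ k :: 'k fps3)" for i j k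
    by (simp add: var_x_def var_y_def var_z_def fps_const_power flip: fps_const_mult)
  have zero: "cartier_fps q r id 0 = (0 :: 'k fps)"
      "cartier_fps q s (cartier_fps q r id) 0 = (0 :: 'k fps fps)"
    by (simp_all add: cartier_fps_def fps_eq_iff)
  have "cartier_fps q r id (fps_X ^ i :: 'k fps) = (if i mod q = r then fps_X ^ (i div q) else 0)"
    using cartier_fps_monomial[of r q id "1 :: 'k" i] assms(1) by simp
  then show ?thesis
    unfolding mono cartier3_def using assms by (simp add: cartier_fps_monomial zero)
qed

lemma frob_basis_fps3:
  obtains I :: "(nat \<times> nat \<times> nat \<times> unit) set" and b \<theta>
  where "frob_basis (CHAR('p::prime_card mod_ring fps3) ^ e) I b (\<theta> :: _ \<Rightarrow> 'p mod_ring fps3 \<Rightarrow> _)"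
proof -
  let ?q = "CARD('p) ^ e"
  \<comment> \<open>Over the prime field the single element 1 is a dual basis; then x, y and z are
    added in turn.\<close>
  have "frob_basis ?q {()} (\<lambda>_. 1) (\<lambda>_. id :: 'p mod_ring \<Rightarrow> _)"
    by (simp add: frob_basis_def cartier_id_mod_ring mod_ring_power_CARD)
  note frob_basis_fps[OF prime_CHAR_fps3(1) _ this, of e]
  then have "frob_basis ?q ({..<?q} \<times> {()}) (\<lambda>(r, i). fps_const 1 * fps_X ^ r)
      (\<lambda>(r, i). cartier_fps ?q r (id :: 'p mod_ring \<Rightarrow> _))" by simp
  note frob_basis_fps[OF prime_CHAR_fps3(2) _ this, of e, simplified semiring_char_fps
      semiring_char_mod_ring, OF refl]
  note frob_basis_fps[OF prime_CHAR_fps3(3) _ this, of e, simplified semiring_char_fps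
      semiring_char_mod_ring, OF refl]
  then show ?thesis by (intro that) (simp only: semiring_char_fps semiring_char_mod_ring)
qed

lemma
  fixes B J :: "'p::prime_card mod_ring fps3 set"
  shows is_ideal_frob_root_fps3: "is_ideal (frob_root B e)"
    and frob_root_subset_iff_fps3: "is_ideal J \<Longrightarrow> frob_root B e \<subseteq> J \<longleftrightarrow> B \<subseteq> frob_power J e"
  by (rule frob_basis_fps3[where ?'p='p and e=e], erule is_ideal_frob_root frob_root_subset_iff, assumption?)+

section \<open>Ideals with finite quotient\<close>

definition finite_colength :: "'a::comm_ring_1 set \<Rightarrow> bool"
  where "finite_colength J \<longleftrightarrow> (\<exists>P. finite P \<and> (\<forall>s. \<exists>t\<in>P. s - t \<in> J))"

text \<open>With P meeting every residue class of D, an ideal K above D is determined by the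
  intersection of K with P.\<close>

lemma finite_ideals_containing:
  assumes "is_ideal D" "finite_colength D"
  shows "finite {K. is_ideal K \<and> D \<subseteq> K}"
proof -
  obtain P where P: "finite P" "\<And>s. \<exists>t\<in>P. s - t \<in> D"
    using assms(2) by (auto simp: finite_colength_def)
  have sub: "K \<subseteq> L" if "is_ideal K" "D \<subseteq> K" "is_ideal L" "D \<subseteq> L" "K \<inter> P = L \<inter> P" for K L
  proof
    fix s assume "s \<in> K"
    obtain t where t: "t \<in> P" "s - t \<in> D" using P(2) by blast
    have "t \<in> K" using that(1,2) t(2) \<open>s \<in> K\<close> is_ideal_diff[of K s "s - t"] by auto
    then have "t \<in> L" using that(5) t(1) by auto
    then have "(s - t) + t \<in> L" using that t by (intro is_ideal_add) auto
    then show "s \<in> L" by simp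
  qed
  show ?thesis
  proof (rule inj_on_finite)
    show "inj_on (\<lambda>K. K \<inter> P) {K. is_ideal K \<and> D \<subseteq> K}"
      using sub by (intro inj_onI subset_antisym) auto
    show "(\<lambda>K. K \<inter> P) ` {K. is_ideal K \<and> D \<subseteq> K} \<subseteq> Pow P" by auto
    show "finite (Pow P)" using P(1) by simp
  qed
qed

lemma is_ideal_vimage_fps_const:
  "is_ideal J \<Longrightarrow> is_ideal {s. fps_const s \<in> J}"
  unfolding is_ideal_iff by (auto simp flip: fps_const_add fps_const_mult)

text \<open>Modulo J a series may be truncated below degree m, and its m remaining coefficients may
  be replaced by representatives from a finite set.\<close>

lemma finite_colength_fps:
  fixes J :: "'a::comm_ring_1 fps set"
  assumes J: "is_ideal J" "fps_X ^ m \<in> J" and "finite_colength {s. fps_const s \<in> J}"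
  shows "finite_colength J"
proof -
  obtain P where P: "finite P" "\<And>s. \<exists>t\<in>P. fps_const (s - t) \<in> J"
    using assms(3) by (auto simp: finite_colength_def)
  define Q where "Q = (\<lambda>c. \<Sum>i<m. fps_const (c i) * fps_X ^ i) ` ({..<m} \<rightarrow>\<^sub>E P)"
  have "\<exists>T\<in>Q. S - T \<in> J" for S
  proof -
    have "\<forall>i. \<exists>t. t \<in> P \<and> fps_const (fps_nth S i - t) \<in> J" using P(2) by blast
    from choice[OF this] obtain c
      where c: "\<And>i. c i \<in> P" "\<And>i. fps_const (fps_nth S i - c i) \<in> J" by auto
    define T where "T = (\<Sum>i<m. fps_const (c i) * fps_X ^ i)"
    have "S - T = (\<Sum>i<m. fps_const (fps_nth S i - c i) * fps_X ^ i) + fps_shift m S * fps_X ^ m"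
      by (rule fps_ext)
        (simp add: T_def fps_sum_nth fps_X_power_nth fps_X_power_mult_right_nth if_distrib
          cong: if_cong)
    also have "\<dots> \<in> J"
      using J c(2) by (intro is_ideal_add is_ideal_sum is_ideal_mult_right is_ideal_mult_left)
    finally have "S - T \<in> J" .
    moreover have "T \<in> Q"
      unfolding Q_def T_def by (rule image_eqI[of _ _ "restrict c {..<m}"]) (simp_all add: c(1))
    ultimately show ?thesis by blast
  qed
  moreover have "finite Q" using P(1) by (simp add: Q_def finite_PiE)
  ultimately show ?thesis unfolding finite_colength_def by blast
qed

lemma finite_colength_fps3:
  fixes J :: "'p::prime_card mod_ring fps3 set"
  assumes "is_ideal J" "var_x ^ m \<in> J" "var_y ^ m \<in> J" "var_z ^ m \<in> J"
  shows "finite_colength J"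
proof -
  \<comment> \<open>J is contracted to k[[x, y]], k[[x]] and k. Over the finite field k finiteness
    is clear, and each variable is put back using its power in J.\<close>
  define J2 where "J2 = {s. fps_const s \<in> J}"
  define J1 where "J1 = {s. fps_const s \<in> J2}"
  define J0 where "J0 = {s. fps_const s \<in> J1}"
  have ideals: "is_ideal J2" "is_ideal J1"
    unfolding J1_def J2_def by (intro is_ideal_vimage_fps_const assms(1))+
  have "s - s \<in> J0" for s
    using is_ideal_zero[OF ideals(2)] by (simp add: J0_def)
  then have "\<forall>s. \<exists>t\<in>UNIV. s - t \<in> J0" by blast
  moreover have "finite (UNIV :: 'p mod_ring set)" by simp
  ultimately have "finite_colength J0"
    unfolding finite_colength_def by blast
  moreover have "fps_X ^ m \<in> J1" "fps_X ^ m \<in> J2" "fps_X ^ m \<in> J"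
    using assms(2-4)
    by (simp_all add: J1_def J2_def var_x_def var_y_def var_z_def fps_const_power)
  ultimately show ?thesis
    using assms(1) ideals unfolding J0_def
    by (metis finite_colength_fps J1_def J2_def)
qed

section \<open>The chain of ideals defining a test ideal\<close>

lemma le_nat_ceiling_mult:
  assumes "c > 0"
  shows "nat \<lceil>x * real c\<rceil> \<le> nat \<lceil>x\<rceil> * c"
proof -
  have "x \<le> real (nat \<lceil>x\<rceil>)" by (rule real_nat_ceiling_ge)
  then have "x * real c \<le> real (nat \<lceil>x\<rceil> * c)" using assms by (simp only: of_nat_mult mult_right_mono of_nat_0_le_iff)
  then show ?thesis by (simp only: nat_ceiling_le_eq)
qed

context
  fixes f :: "'p::prime_card mod_ring fps3"
begin

definition power_root :: "nat \<Rightarrow> nat \<Rightarrow> 'p mod_ring fps3 set"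
  where "power_root m e = frob_root (ideal_gen {f ^ m}) e"

text \<open>The sequence whose eventual value is the test ideal, studied before it is known to
  stabilize. For l < 0 the exponent becomes 0 through \<open>nat\<close>.\<close>

definition test_chain :: "real \<Rightarrow> nat \<Rightarrow> 'p mod_ring fps3 set"
  where "test_chain l e = power_root (nat \<lceil>l * real (CARD('p) ^ e)\<rceil>) e"

lemma is_ideal_power_root: "is_ideal (power_root m e)"
  by (simp add: power_root_def is_ideal_frob_root_fps3)

lemma power_root_subset_iff: "is_ideal J \<Longrightarrow> power_root m e \<subseteq> J \<longleftrightarrow> f ^ m \<in> frob_power J e"
  by (simp add: power_root_def frob_root_subset_iff_fps3 ideal_gen_subset_iff frob_power_is_ideal)

lemma power_mem_frob_power_power_root: "f ^ m \<in> frob_power (power_root m e) e"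
  using power_root_subset_iff is_ideal_power_root by blast

lemma power_root_antimono:
  assumes "m \<le> m'"
  shows "power_root m' e \<subseteq> power_root m e"
proof -
  have "f ^ m' = f ^ (m' - m) * f ^ m" using assms by (simp flip: power_add)
  then show ?thesis
    by (simp add: power_root_subset_iff is_ideal_power_root power_mem_frob_power_power_root
        is_ideal_mult_left frob_power_is_ideal)
qed

lemma power_root_mult_subset: "power_root (m * CARD('p) ^ k) (e + k) \<subseteq> power_root m e"
  using frob_power_power[OF prime_CHAR_fps3(4) power_mem_frob_power_power_root[of m e], of k]
  by (simp add: power_root_subset_iff is_ideal_power_root power_mult)

text \<open>Since \<theta> (f^s) = 1, the s additional factors f are absorbed when the p^k-th power
  is cancelled. With s = 0 this gives \<open>power_root_mult\<close>, with s = 1 right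
  continuity.\<close>

lemma power_root_subset_mult_add:
  assumes "cartier (CARD('p) ^ k) \<theta>" "\<theta> (f ^ s) = 1"
  shows "power_root m e \<subseteq> power_root (m * CARD('p) ^ k + s) (e + k)"
  using mem_frob_power_cancel[of k \<theta> "f ^ s" "f ^ m" _ e] assms
    power_mem_frob_power_power_root[of "m * CARD('p) ^ k + s" "e + k"]
  by (simp add: power_root_subset_iff is_ideal_power_root power_mult power_add)

lemma power_root_mult: "power_root (m * CARD('p) ^ k) (e + k) = power_root m e"
proof -
  let ?\<theta> = "cartier3 (CARD('p) ^ k) 0 0 0 :: 'p mod_ring fps3 \<Rightarrow> _"
  have "?\<theta> (f ^ 0) = 1" using cartier3_monomial[of 0 "CARD('p) ^ k" 0 0 0 0 0] by simp
  moreover have "cartier (CARD('p) ^ k) ?\<theta>" by (intro cartier_cartier3) auto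
  ultimately show ?thesis
    using power_root_subset_mult_add[of k ?\<theta> 0 m e] power_root_mult_subset[of m k e] by auto
qed

lemma is_ideal_test_chain: "is_ideal (test_chain l e)"
  by (simp add: test_chain_def is_ideal_power_root)

lemma test_chain_antimono: "l \<le> l' \<Longrightarrow> test_chain l' e \<subseteq> test_chain l e"
  unfolding test_chain_def by (intro power_root_antimono nat_mono ceiling_mono mult_right_mono) auto

text \<open>Rounding up at stage e and then multiplying by p gives at least the exponent of stage e
  + 1, and a smaller exponent means a larger root.\<close>

lemma incseq_test_chain: "incseq (test_chain l)"
proof (rule incseq_SucI)
  fix e
  have "nat \<lceil>l * real (CARD('p) ^ Suc e)\<rceil> \<le> nat \<lceil>l * real (CARD('p) ^ e)\<rceil> * CARD('p) ^ 1"
    using le_nat_ceiling_mult[of "CARD('p)" "l * real (CARD('p) ^ e)"] by (simp add: mult_ac)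
  from power_root_antimono[OF this, of "Suc e"] show "test_chain l e \<subseteq> test_chain l (Suc e)"
    using power_root_mult[of _ 1 e] by (simp add: test_chain_def)
qed

text \<open>From stage e on the ceiling is exact, so the chain is constant.\<close>

lemma test_chain_of_nat_divide:
  assumes "e \<le> e'"
  shows "test_chain (real m / real (CARD('p) ^ e)) e' = power_root m e"
proof -
  have "real m / real (CARD('p) ^ e) * real (CARD('p) ^ e') = real (m * CARD('p) ^ (e' - e))"
    using power_add[of "real CARD('p)" e "e' - e"] assms by simp
  then have "nat \<lceil>real m / real (CARD('p) ^ e) * real (CARD('p) ^ e')\<rceil> = m * CARD('p) ^ (e' - e)"
    by (metis ceiling_of_nat nat_int)
  then show ?thesis using power_root_mult[of m "e' - e" e] assms by (simp add: test_chain_def)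
qed

lemma test_ideal_eqI:
  assumes "\<And>e. e \<ge> e0 \<Longrightarrow> test_chain l e = J"
  shows "test_ideal (ideal_gen {f}) l = J"
proof -
  have ev: "\<forall>\<^sub>F e in sequentially. test_chain l e = J"
    using assms by (auto simp: eventually_sequentially)
  have "test_ideal (ideal_gen {f}) l = (THE J. \<forall>\<^sub>F e in sequentially. test_chain l e = J)"
    by (simp add: test_ideal_def test_chain_def power_root_def ideal_power_principal)
  also have "\<dots> = J"
  proof (rule the_equality[where P = "\<lambda>J. \<forall>\<^sub>F e in sequentially. test_chain l e = J", OF ev])
    fix K assume "\<forall>\<^sub>F e in sequentially. test_chain l e = K"
    with ev have "\<forall>\<^sub>F e in sequentially. K = J" by eventually_elim simp
    then show "K = J" by simp
  qed
  finally show ?thesis .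
qed

text \<open>From e1 on the increasing chain takes finitely many values; a maximal one is
  final.\<close>

lemma test_chain_stabilizes:
  assumes "finite {K. is_ideal K \<and> test_chain l e1 \<subseteq> K}"
  shows "\<exists>e0. \<forall>e\<ge>e0. test_chain l e = test_chain l e0"
proof -
  have "finite (test_chain l ` {e1..})"
    using incseq_test_chain by (intro finite_subset[OF _ assms]) (auto simp: is_ideal_test_chain incseq_def)
  then have "\<exists>K\<in>test_chain l ` {e1..}. \<forall>L\<in>test_chain l ` {e1..}. K \<subseteq> L \<longrightarrow> K = L"
    by (rule finite_has_maximal) simp
  then obtain e0 where "e0 \<ge> e1"
    and maximal: "\<And>e. e \<ge> e1 \<Longrightarrow> test_chain l e0 \<subseteq> test_chain l e \<Longrightarrow> test_chain l e0 = test_chain l e"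
    by auto
  have "test_chain l e = test_chain l e0" if "e \<ge> e0" for e
    using maximal[of e] incseqD[OF incseq_test_chain that] that \<open>e0 \<ge> e1\<close> by simp
  then show ?thesis by blast
qed

end

text \<open>The condition \<theta> f = 1 yields right continuity, so g is already lost at the
  supremum s of the exponents in [\<alpha>, \<beta>] whose test ideal contains g. Hence s >
  \<alpha>, while g belongs to the test ideal at every exponent below s.\<close>

lemma F_jumping_number_between:
  fixes f :: "'p::prime_card mod_ring fps3" and \<theta> :: "'p mod_ring fps3 \<Rightarrow> _"
  assumes stab: "\<And>l. l \<le> \<beta> \<Longrightarrow> \<exists>e0. \<forall>e\<ge>e0. test_chain f l e = test_chain f l e0"
    and \<theta>: "cartier (CARD('p) ^ k) \<theta>" "\<theta> f = 1"
    and "0 \<le> \<alpha>" "\<alpha> \<le> \<beta>"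
    and g: "g \<in> test_ideal (ideal_gen {f}) \<alpha>" "g \<notin> test_ideal (ideal_gen {f}) \<beta>"
  shows "\<exists>l\<in>{\<alpha><..\<beta>}. F_jumping_number (ideal_gen {f}) l"
proof -
  let ?\<tau> = "test_ideal (ideal_gen {f})"
  have reached: "\<exists>e0. \<forall>e\<ge>e0. test_chain f l e = ?\<tau> l" if l: "l \<le> \<beta>" for l
  proof -
    from stab[OF l] obtain e0 where e0: "\<And>e. e \<ge> e0 \<Longrightarrow> test_chain f l e = test_chain f l e0" by blast
    then have "?\<tau> l = test_chain f l e0" by (rule test_ideal_eqI)
    with e0 show ?thesis by metis
  qed
  have test_chain_subset: "test_chain f l e \<subseteq> ?\<tau> l" if l: "l \<le> \<beta>" for l e
  proof -
    from reached[OF l] obtain e0 where "test_chain f l (max e e0) = ?\<tau> l"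
      by (meson max.cobounded2)
    with incseqD[OF incseq_test_chain, of e "max e e0" f l] show ?thesis by auto
  qed
  have antimono: "?\<tau> l' \<subseteq> ?\<tau> l" if "l \<le> l'" "l' \<le> \<beta>" for l l'
  proof -
    from reached[OF that(2)] obtain e where "test_chain f l' e = ?\<tau> l'" by auto
    with test_chain_antimono[OF that(1), of f e] test_chain_subset[of l e] that show ?thesis by auto
  qed
  have right_continuous: "\<exists>l'>l. l' \<le> \<beta> \<and> ?\<tau> l \<subseteq> ?\<tau> l'" if l: "l < \<beta>" for l
  proof -
    obtain e where e: "test_chain f l e = ?\<tau> l" using reached[of l] l by auto
    define m where "m = nat \<lceil>l * real (CARD('p) ^ e)\<rceil>"
    \<comment> \<open>Refining the denominator by p^k leaves room for one extra factor f without
      shrinking the root; this one makes l' strictly larger than l.\<close>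
    define l' where "l' = real (m * CARD('p) ^ k + 1) / real (CARD('p) ^ (e + k))"
    have "l * real (CARD('p) ^ e) \<le> real m" unfolding m_def by (rule real_nat_ceiling_ge)
    then have "l * real (CARD('p) ^ e) * real (CARD('p) ^ k) \<le> real m * real (CARD('p) ^ k)"
      by (rule mult_right_mono) simp
    also have "\<dots> < real (m * CARD('p) ^ k + 1)" by simp
    also have "l * real (CARD('p) ^ e) * real (CARD('p) ^ k) = l * real (CARD('p) ^ (e + k))"
      by (simp add: power_add)
    finally have "l * real (CARD('p) ^ (e + k)) < real (m * CARD('p) ^ k + 1)" .
    then have "l < l'" unfolding l'_def by (subst pos_less_divide_eq) simp_all
    have "?\<tau> l = power_root f m e" using e by (simp add: test_chain_def m_def)
    also have "\<dots> \<subseteq> power_root f (m * CARD('p) ^ k + 1) (e + k)"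
      using power_root_subset_mult_add[of k \<theta> f 1 m e] \<theta> by simp
    also have "\<dots> = test_chain f l' (e + k)"
      unfolding l'_def by (rule test_chain_of_nat_divide[symmetric]) simp
    \<comment> \<open>The minimum stays in the range where stabilization is known.\<close>
    also have "\<dots> \<subseteq> test_chain f (min l' \<beta>) (e + k)" by (rule test_chain_antimono) simp
    also have "\<dots> \<subseteq> ?\<tau> (min l' \<beta>)" by (rule test_chain_subset) simp
    finally show ?thesis using \<open>l < l'\<close> l by (intro exI[of _ "min l' \<beta>"]) auto
  qed
  define S where "S = {l. \<alpha> \<le> l \<and> l \<le> \<beta> \<and> g \<in> ?\<tau> l}"
  define s where "s = Sup S"
  have "\<alpha> \<in> S" using g(1) \<open>\<alpha> \<le> \<beta>\<close> by (simp add: S_def)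
  have bdd: "bdd_above S" unfolding S_def by (rule bdd_aboveI[of _ \<beta>]) simp
  have "\<alpha> \<le> s" unfolding s_def by (rule cSup_upper[OF \<open>\<alpha> \<in> S\<close> bdd])
  have "s \<le> \<beta>" unfolding s_def using \<open>\<alpha> \<in> S\<close> by (intro cSup_least) (auto simp: S_def)
  have not_mem: "g \<notin> ?\<tau> s"
  proof
    assume "g \<in> ?\<tau> s"
    with g(2) \<open>s \<le> \<beta>\<close> have "s < \<beta>" by (metis less_eq_real_def)
    from right_continuous[OF this] obtain l where "l > s" "l \<le> \<beta>" "?\<tau> s \<subseteq> ?\<tau> l" by blast
    with \<open>g \<in> ?\<tau> s\<close> \<open>\<alpha> \<le> s\<close> have "l \<in> S" by (auto simp: S_def)
    then have "l \<le> s" unfolding s_def using bdd by (rule cSup_upper)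
    with \<open>l > s\<close> show False by simp
  qed
  with g(1) have "s \<noteq> \<alpha>" by auto
  with \<open>\<alpha> \<le> s\<close> have "\<alpha> < s" by simp
  moreover have "?\<tau> s \<noteq> ?\<tau> m" if "m < s" for m
  proof -
    obtain l where "l \<in> S" "m < l"
      using \<open>m < s\<close> \<open>\<alpha> \<in> S\<close> less_cSup_iff[OF _ bdd] unfolding s_def by blast
    then have "g \<in> ?\<tau> m" using antimono[of m l] by (auto simp: S_def)
    with not_mem show ?thesis by blast
  qed
  ultimately show ?thesis
    using \<open>s \<le> \<beta>\<close> \<open>0 \<le> \<alpha>\<close> by (intro bexI[of _ s]) (auto simp: F_jumping_number_def)
qed

section \<open>Binomial coefficients modulo a prime\<close>

lemma trinomial:
  fixes u v w :: "'a::comm_semiring_1"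
  shows "(u + v + w) ^ N = (\<Sum>i\<le>N. \<Sum>j\<le>N - i.
    of_nat ((N choose i) * (N - i choose j)) * (u ^ i * v ^ j * w ^ (N - i - j)))"
  by (simp add: add.assoc binomial_ring[of u] binomial_ring[of v] sum_distrib_left mult_ac)

text \<open>Legendre's formula in recursive form: only the n div p multiples of p up to n count, and
  dividing each by p leaves the factorial of n div p.\<close>

lemma multiplicity_fact:
  assumes "prime p"
  shows "multiplicity p (fact n) = n div p + multiplicity p (fact (n div p) :: nat)"
proof (induction n)
  case (Suc n)
  have nz: "p > 0" "p \<noteq> 1" using assms by (auto simp: prime_gt_0_nat)
  have pe: "prime_elem p" using assms by simp
  show ?case
  proof (cases "p dvd Suc n")
    case True
    then obtain k where k: "Suc n = p * k" by auto
    then obtain k' where k': "k = Suc k'" by (cases k) auto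
    have "Suc n div p = Suc k'" using k k' nz by simp
    moreover have "n div p = k'"
      by (rule div_nat_eqI) (use k k' nz in \<open>simp_all flip: less_Suc_eq_le\<close>)
    moreover have "multiplicity p (Suc n) = Suc (multiplicity p (Suc k'))"
      unfolding k k' using nz pe assms
      by (simp add: prime_elem_multiplicity_mult_distrib del: mult_Suc_right)
    ultimately show ?thesis
      using Suc pe by (simp add: prime_elem_multiplicity_mult_distrib del: of_nat_Suc mult_Suc_right mult_Suc)
  next
    case False
    then have "Suc n div p = n div p" by (simp add: div_Suc dvd_eq_mod_eq_0)
    moreover have "multiplicity p (Suc n) = 0" using False by (rule not_dvd_imp_multiplicity_0)
    ultimately show ?thesis
      using Suc pe by (simp add: prime_elem_multiplicity_mult_distrib del: of_nat_Suc mult_Suc_right mult_Suc)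
  qed
qed simp

text \<open>One step of Kummer's theorem. The last assumption says that adding k and n - k gives no
  carry out of the lowest base-p digit, so the linear terms of Legendre's formula cancel.\<close>

lemma prime_dvd_choose_iff_div:
  fixes p n k :: nat
  assumes "prime p" "k \<le> n" "n div p = k div p + (n - k) div p"
  shows "p dvd (n choose k) \<longleftrightarrow> p dvd (n div p choose (k div p))"
proof -
  have mult: "multiplicity p (n choose k) + multiplicity p (fact k :: nat) + multiplicity p (fact (n - k) :: nat)
      = multiplicity p (fact n :: nat)" if "k \<le> n" for n k :: nat
  proof -
    have "(fact n :: nat) = (n choose k) * fact k * fact (n - k)"
      using binomial_fact_lemma[OF that] by (simp add: mult_ac)
    then show ?thesis
      using assms(1) that by (simp add: prime_elem_multiplicity_mult_distrib)
  qed
  have le: "k div p \<le> n div p" using assms(2) by (rule div_le_mono)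
  have "n div p - k div p = (n - k) div p" using assms(3) by simp
  with mult[OF assms(2)] mult[OF le] assms(3)
  have "multiplicity p (n choose k) = multiplicity p (n div p choose (k div p))"
    by (simp add: multiplicity_fact[OF assms(1), of n] multiplicity_fact[OF assms(1), of k]
        multiplicity_fact[OF assms(1), of "n - k"])
  moreover have "p dvd c \<longleftrightarrow> multiplicity p c > 0" if "c > 0" for c
    using that assms(1) by (metis multiplicity_gt_zero_iff not_prime_unit less_numeral_extra(3))
  ultimately show ?thesis using assms(2) le by simp
qed

text \<open>All base-p digits of p^e - 1 equal p - 1, so adding k and p^e - 1 - k never carries; the
  induction strips the digits.\<close>

lemma prime_not_dvd_choose_prime_power_minus_one:
  fixes p :: nat
  assumes "prime p" "k \<le> p ^ e - 1"
  shows "\<not> p dvd (p ^ e - 1 choose k)"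
  using assms(2)
proof (induction e arbitrary: k)
  case 0
  with assms(1) show ?case by (auto dest: not_prime_unit)
next
  case (Suc e)
  have p: "p > 0" using assms(1) by (simp add: prime_gt_0_nat)
  \<comment> \<open>The last digit of p * m - 1 is p - 1, so subtracting k needs no borrow from the
    higher digits.\<close>
  have div: "(p * m - 1 - k) div p = m - 1 - k div p" if "k < p * m" for m k
  proof -
    have "k div p < m" using that p by (metis less_mult_imp_div_less mult.commute)
    then obtain t where t: "m = k div p + Suc t" using less_imp_Suc_add by fastforce
    have "p * m = p * (k div p) + p + t * p" by (simp add: t distrib_left)
    moreover have "p * (k div p) + k mod p = k" "k mod p < p" using p by simp_all
    ultimately have "p * m - 1 - k = (p - 1 - k mod p) + t * p" by linarith
    moreover have "(p - 1 - k mod p) div p = 0" using p by simp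
    ultimately have "(p * m - 1 - k) div p = t" using p by simp
    with t show ?thesis by simp
  qed
  have "p ^ Suc e > 0" using p by simp
  with Suc.prems have "k < p ^ Suc e" by linarith
  then have k: "k < p * p ^ e" by simp
  then have "k div p < p ^ e" by (simp add: less_mult_imp_div_less mult.commute)
  then have le: "k div p \<le> p ^ e - 1" by simp
  have "(p ^ Suc e - 1) div p = p ^ e - 1" using div[of 0 "p ^ e"] p by simp
  moreover have "(p ^ Suc e - 1 - k) div p = p ^ e - 1 - k div p" using div[OF k] by simp
  ultimately have "p dvd (p ^ Suc e - 1 choose k) \<longleftrightarrow> p dvd (p ^ e - 1 choose (k div p))"
    using prime_dvd_choose_iff_div[OF assms(1) Suc.prems] le
    by (simp only: le_add_diff_inverse)
  with Suc.IH[OF le] show ?case by simp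
qed

text \<open>Appending to m a last digit d < p/2 creates no new carry in doubling.\<close>

lemma prime_not_dvd_central_binomial_step:
  fixes p :: nat
  assumes "prime p" "2 * d < p" "\<not> p dvd (2 * m choose m)"
  shows "\<not> p dvd (2 * (p * m + d) choose (p * m + d))"
proof -
  have "p * m + d = d + m * p" "2 * (p * m + d) = 2 * d + (2 * m) * p" by simp_all
  then have "(p * m + d) div p = m" "2 * (p * m + d) div p = 2 * m"
    using assms(2) by (simp_all only: div_mult_self1) simp_all
  moreover have "2 * (p * m + d) - (p * m + d) = p * m + d" by simp
  ultimately have "p dvd (2 * (p * m + d) choose (p * m + d)) \<longleftrightarrow> p dvd (2 * m choose m)"
    using prime_dvd_choose_iff_div[OF assms(1), of "p * m + d" "2 * (p * m + d)"]
    by (simp only: mult_2 le_add1)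
  with assms(3) show ?thesis by simp
qed

section \<open>The powers of a Fermat series\<close>

lemma mem_ideal_of_nat_mult_cancel:
  fixes J :: "'a::comm_ring_1 set"
  assumes "is_ideal J" "prime CHAR('a)" "\<not> CHAR('a) dvd c" "of_nat c * g \<in> J"
  shows "g \<in> J"
proof -
  have "coprime c CHAR('a)"
    using assms(2,3) by (metis coprime_commute prime_imp_coprime)
  then obtain d where "[c * d = Suc 0] (mod CHAR('a))"
    using cong_solve_coprime_nat by blast
  then have "of_nat (c * d) = (1 :: 'a)"
    by (metis One_nat_def of_nat_1 of_nat_eq_iff_cong_CHAR)
  then have "of_nat d * (of_nat c * g) = g"
    by (simp add: mult_ac flip: mult.assoc)
  with is_ideal_mult_left[OF assms(1,4), of "of_nat d"] show ?thesis by simp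
qed

definition fermat_series :: "nat \<Rightarrow> 'k::comm_ring_1 fps3"
  where "fermat_series a = var_x ^ a + var_y ^ a + var_z ^ a"

lemma fermat_series_power:
  "fermat_series a ^ N = (\<Sum>i\<le>N. \<Sum>j\<le>N - i. of_nat ((N choose i) * (N - i choose j)) *
    (var_x ^ (a * i) * var_y ^ (a * j) * var_z ^ (a * (N - i - j))))"
  by (simp add: fermat_series_def trinomial power_mult)

lemma mult_mod_eq_iff:
  fixes a q i j :: nat
  assumes "coprime a q" "i < q" "j < q"
  shows "a * i mod q = a * j mod q \<longleftrightarrow> i = j"
proof -
  have "[a * i = a * j] (mod q) \<longleftrightarrow> [i = j] (mod q)"
    using assms(1) by (simp add: cong_mult_lcancel_nat)
  then show ?thesis using assms(2,3) by (simp add: cong_def)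
qed

text \<open>
  The exponents of distinct terms are incongruent modulo \<open>p\<^sup>e\<close>, so a Cartier map isolates one term.
\<close>

lemma monomial_mem_power_root_fermat_series:
  fixes a e i j N :: nat
  defines "q \<equiv> CARD('p::prime_card) ^ e"
  assumes cop: "coprime a CARD('p)" and N: "N = q - 1" and ij: "i + j \<le> N"
    and ndvd: "\<not> CARD('p) dvd (N choose i) * (N - i choose j)"
  shows "var_x ^ (a * i div q) * var_y ^ (a * j div q) * var_z ^ (a * (N - i - j) div q)
    \<in> power_root (fermat_series a :: 'p mod_ring fps3) N e"
proof -
  let ?f = "fermat_series a :: 'p mod_ring fps3"
  let ?M = "var_x ^ (a * i div q) * var_y ^ (a * j div q) * var_z ^ (a * (N - i - j) div q)
    :: 'p mod_ring fps3"
  let ?c = "\<lambda>i j. (N choose i) * (N - i choose j)"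
  let ?\<theta> = "cartier3 q (a * i mod q) (a * j mod q) (a * (N - i - j) mod q)
    :: 'p mod_ring fps3 \<Rightarrow> _"
  have "q > 0" by (simp add: q_def)
  have cartier: "cartier q ?\<theta>"
    using \<open>q > 0\<close> by (intro cartier_cartier3[where e=e]) (simp_all add: q_def)
  have "coprime a q" using cop by (simp add: q_def)
  have mono: "?\<theta> (var_x ^ (a * i') * var_y ^ (a * j') * var_z ^ (a * (N - i' - j')))
      = (if j' = j then if i' = i then ?M else 0 else 0)" if "i' \<le> N" "j' \<le> N - i'" for i' j'
  proof -
    \<comment> \<open>Being below q, the indices are recovered from the residues of the exponents,
      as a is invertible modulo q.\<close>
    have "i' < q" "j' < q" "i < q" "j < q" using that ij N \<open>q > 0\<close> by linarith+
    then show ?thesis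
      using \<open>q > 0\<close> mult_mod_eq_iff[OF \<open>coprime a q\<close>] by (auto simp: cartier3_monomial)
  qed
  have "?\<theta> (?f ^ N) = (\<Sum>i'\<le>N. \<Sum>j'\<le>N - i'. of_nat (?c i' j') *
      ?\<theta> (var_x ^ (a * i') * var_y ^ (a * j') * var_z ^ (a * (N - i' - j'))))"
    by (simp only: fermat_series_power cartier_sum[OF cartier] cartier_of_nat_mult[OF cartier])
  also have "\<dots> = (\<Sum>i'\<le>N. \<Sum>j'\<le>N - i'. if j' = j then if i' = i then of_nat (?c i j) * ?M else 0 else 0)"
    by (intro sum.cong refl) (simp add: mono del: diff_diff_left)
  also have "\<dots> = (\<Sum>i'\<le>N. if i' = i then of_nat (?c i j) * ?M else 0)"
    using ij by (intro sum.cong refl) auto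
  also have "\<dots> = of_nat (?c i j) * ?M"
    using ij by simp
  finally have mem: "of_nat (?c i j) * ?M \<in> power_root ?f N e"
    using cartier_frob_power[of e ?\<theta> "power_root ?f N e" "?f ^ N"] cartier
      power_mem_frob_power_power_root[of ?f N e]
    by (simp add: is_ideal_power_root q_def)
  have "\<not> CHAR('p mod_ring fps3) dvd ?c i j" using ndvd by (simp only: CHAR_fps3 not_False_eq_True)
  from mem_ideal_of_nat_mult_cancel[OF is_ideal_power_root prime_CHAR_fps3(4) this mem]
  show ?thesis .
qed

section \<open>Monomial bounds for the Frobenius roots\<close>

lemma mem_ideal_power_le:
  fixes u :: "'a::comm_ring_1"
  assumes "is_ideal J" "u ^ m \<in> J" "m \<le> n"
  shows "u ^ n \<in> J"
proof -
  have "u ^ (n - m) * u ^ m \<in> J" by (intro is_ideal_mult_left assms(1,2))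
  also have "u ^ (n - m) * u ^ m = u ^ n"
    using assms(3) by (simp only: le_add_diff_inverse2 flip: power_add)
  finally show ?thesis .
qed

text \<open>The three terms of the power involving a single variable have coefficient 1, so the root
  contains x^a, y^a and z^a.\<close>

lemma finite_ideals_containing_power_root_fermat_series:
  assumes "coprime a CARD('p::prime_card)"
  shows "finite {K. is_ideal K \<and>
    power_root (fermat_series a :: 'p mod_ring fps3) (CARD('p) ^ e - 1) e \<subseteq> K}"
proof (rule finite_ideals_containing[OF is_ideal_power_root finite_colength_fps3[OF is_ideal_power_root]])
  let ?q = "CARD('p) ^ e"
  let ?I = "power_root (fermat_series a :: 'p mod_ring fps3) (?q - 1) e"
  have "a * (?q - 1) div ?q \<le> a * ?q div ?q"
    by (intro div_le_mono mult_le_mono2) simp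
  then have le: "u ^ a \<in> ?I" if "u ^ (a * (?q - 1) div ?q) \<in> ?I" for u
    using that by (intro mem_ideal_power_le[OF is_ideal_power_root that]) simp
  have "\<not> CARD('p) dvd 1"
    using prime_card[where ?'a='p] by (auto dest: not_prime_unit)
  note mono = monomial_mem_power_root_fermat_series[OF assms refl, where e=e]
  show "var_x ^ a \<in> ?I" "var_y ^ a \<in> ?I" "var_z ^ a \<in> ?I"
    using mono[of "?q - 1" 0] mono[of 0 "?q - 1"] mono[of 0 0] \<open>\<not> CARD('p) dvd 1\<close>
    by (intro le; simp)+
qed

text \<open>The ideal (x, y, z^m), given by coefficients so that non-membership of a monomial can be
  read off.\<close>

definition z_axis_ideal :: "nat \<Rightarrow> 'k::comm_ring_1 fps3 set"
  where "z_axis_ideal m = {F. \<forall>k<m. coeff3 F (0, 0, k) = 0}"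

lemma is_ideal_z_axis_ideal: "is_ideal (z_axis_ideal m)"
proof -
  have "coeff3 (r * F) (0, 0, k) = 0" if "F \<in> z_axis_ideal m" "k < m" for r F :: "'a fps3" and k
    using that by (auto simp: coeff3_mult z_axis_ideal_def intro!: sum.neutral)
  moreover have "coeff3 0 u = 0" for u by (cases u) (simp add: coeff3_def)
  ultimately show ?thesis
    unfolding is_ideal_iff by (auto simp: z_axis_ideal_def coeff3_add)
qed

lemma monomial_mem_z_axis_ideal:
  "var_x ^ i * var_y ^ j * var_z ^ k \<in> z_axis_ideal m \<longleftrightarrow> i > 0 \<or> j > 0 \<or> m \<le> k"
  by (auto simp: z_axis_ideal_def coeff3_monomial)

lemma monomial_mem_frob_power_z_axis_ideal:
  fixes i j k m e :: nat
  assumes q: "q = CARD('p::prime_card) ^ e" and "q \<le> i \<or> q \<le> j \<or> m * q \<le> k"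
  shows "var_x ^ i * var_y ^ j * var_z ^ k \<in> frob_power (z_axis_ideal m :: 'p mod_ring fps3 set) e"
    (is "_ \<in> ?J")
proof -
  have J: "is_ideal ?J" by (rule frob_power_is_ideal)
  have mem: "u ^ n \<in> ?J" if "u \<in> z_axis_ideal m" "q \<le> n" for u :: "'p mod_ring fps3" and n
    using mem_ideal_power_le[OF J, of u q n] mem_frob_power[OF that(1), of e] that(2) q by simp
  have "var_x \<in> z_axis_ideal m" "var_y \<in> z_axis_ideal m" "var_z ^ m \<in> z_axis_ideal m"
    using monomial_mem_z_axis_ideal[of 1 0 0 m] monomial_mem_z_axis_ideal[of 0 1 0 m]
      monomial_mem_z_axis_ideal[of 0 0 m m] by simp_all
  note vars = this[THEN mem]
  have "var_z ^ k \<in> ?J" if "m * q \<le> k"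
    using vars(3)[OF order_refl] that
    by (intro mem_ideal_power_le[OF J _ that]) (simp only: power_mult)
  with assms(2) vars(1)[of i] vars(2)[of j]
  consider "var_x ^ i \<in> ?J" | "var_y ^ j \<in> ?J" | "var_z ^ k \<in> ?J" by blast
  then show ?thesis
    using J by cases (auto intro: is_ideal_mult_left is_ideal_mult_right)
qed

text \<open>The witness is m = (p^e - 2^e) / a. Passing to e + 1 replaces m by p * m + 2^e * d, so
  the base-p digits are 2^j * d with j < e, all below p/2.\<close>

lemma exists_binomial_witness:
  fixes p a d n e :: nat
  assumes "prime p" "p = a * d + 2" "a = 2 ^ (n + 1) + 1" "e \<le> n"
  shows "\<exists>m. a * m + 2 ^ e = p ^ e \<and> \<not> p dvd (2 * m choose m)"
  using assms(4)
proof (induction e)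
  case 0
  then show ?case using assms(1) by (intro exI[of _ 0]) (auto dest: not_prime_unit)
next
  case (Suc e)
  then obtain m where m: "a * m + 2 ^ e = p ^ e" "\<not> p dvd (2 * m choose m)" by auto
  \<comment> \<open>The bound on the exponent enters here: it makes twice the new digit at most a *
    d = p - 2.\<close>
  have "(2::nat) ^ Suc e \<le> 2 ^ n" using Suc.prems by (intro power_increasing) simp_all
  then have "2 * 2 ^ e \<le> a" using assms(3) by simp
  then have "2 * (2 ^ e * d) \<le> a * d" by (metis mult.assoc mult_le_mono1)
  then have "2 * (2 ^ e * d) < p" using assms(2) by linarith
  from prime_not_dvd_central_binomial_step[OF assms(1) this m(2)]
  have "\<not> p dvd (2 * (p * m + 2 ^ e * d) choose (p * m + 2 ^ e * d))" .
  moreover have "a * (p * m + 2 ^ e * d) + 2 ^ Suc e = p ^ Suc e"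
  proof -
    have "a * (p * m + 2 ^ e * d) + 2 ^ Suc e = p * (a * m) + 2 ^ e * (a * d + 2)"
      by (simp add: algebra_simps)
    also have "\<dots> = p * (a * m + 2 ^ e)" using assms(2) by (simp add: algebra_simps)
    finally show ?thesis using m(1) by simp
  qed
  ultimately show ?case by blast
qed

lemma var_z_power_mem_power_root:
  fixes a n :: nat
  assumes "coprime a CARD('p::prime_card)" "CARD('p) = a * d + 2" "a = 2 ^ (n + 1) + 1"
  shows "var_z ^ (a - 3) \<in> power_root (fermat_series a :: 'p mod_ring fps3) (CARD('p) ^ n - 1) n"
proof -
  let ?p = "CARD('p)"
  define q where "q = ?p ^ n"
  have p: "prime ?p" by (rule prime_card)
  obtain m where m: "a * m + 2 ^ n = q" "\<not> ?p dvd (2 * m choose m)"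
    using exists_binomial_witness[OF p assms(2,3), of n] by (auto simp: q_def)
  have "a \<ge> 3" using assms(3) by simp
  have pow2: "(2::nat) ^ n > 0" by simp
  have "3 * m \<le> a * m" using \<open>a \<ge> 3\<close> by simp
  with m(1) pow2 have 2: "2 * m \<le> q - 1" by linarith
  \<comment> \<open>The trinomial coefficient for i = j = m is regrouped so that the central
    binomial coefficient appears.\<close>
  have "(q - 1 choose (2 * m)) * (2 * m choose m) = (q - 1 choose m) * (q - 1 - m choose m)"
    using choose_mult[of m "2 * m" "q - 1"] 2 by simp
  moreover have "\<not> ?p dvd (q - 1 choose (2 * m)) * (2 * m choose m)"
    using prime_not_dvd_choose_prime_power_minus_one[OF p, of "2 * m" n] 2 m(2) p
    by (simp add: prime_dvd_mult_iff q_def)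
  ultimately have ndvd: "\<not> ?p dvd (q - 1 choose m) * (q - 1 - m choose m)" by simp
  have "a * m < q" using m(1) pow2 by linarith
  then have "a * m div q = 0" by simp
  \<comment> \<open>From a * m = q - 2^n and a = 2 * 2^n + 1 the exponent is (a - 2) * q - 1, just
    below a multiple of q.\<close>
  moreover have "a * (q - 1 - m - m) div q = a - 3"
  proof (rule div_nat_eqI)
    obtain b where b: "a = b + 3" using \<open>a \<ge> 3\<close> by (metis add.commute le_Suc_ex)
    define k where "k = q - 1 - m - m"
    have k: "q = k + 2 * m + 1" using 2 m(1) pow2 unfolding k_def by linarith
    have "a * k + a + 2 * (a * m) = a * q" using k by (simp add: algebra_simps)
    then have "a * k + a + 2 * q = a * q + 2 * 2 ^ n" using m(1) by (simp add: algebra_simps)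
    moreover have "a = 2 * 2 ^ n + 1" using assms(3) by simp
    ultimately have "a * k + 1 + 2 * q = a * q" by linarith
    then have "a * k + 1 = q * b + q" using b by (simp add: algebra_simps)
    moreover have "q \<ge> 1" using m(1) pow2 by linarith
    ultimately have "q * b \<le> a * k" "a * k < q * Suc b" by simp_all
    then show "q * (a - 3) \<le> a * (q - 1 - m - m)" "a * (q - 1 - m - m) < q * Suc (a - 3)"
      using b unfolding k_def by simp_all
  qed
  ultimately show ?thesis
    using monomial_mem_power_root_fermat_series[OF assms(1), of "q - 1" n m m] 2 ndvd
    by (simp add: q_def)
qed

text \<open>Let q = p^e. If a * i and a * j are below q < a * c, then i and j are at most c - 1, so
  a * (i + j + 2) \<le> 2 * (q + 1). The exponent of z is then at least (a - 2) * (q + 1), so every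
  term lies in the bracket power.\<close>

lemma power_root_subset_z_axis_ideal:
  fixes a e :: nat
  assumes "CARD('p::prime_card) ^ e + 1 = a * c" "a \<ge> 2"
  shows "power_root (fermat_series a :: 'p mod_ring fps3) (CARD('p) ^ e - 1) e \<subseteq> z_axis_ideal (a - 2)"
proof -
  define q where "q = CARD('p) ^ e"
  have q: "q + 1 = a * c" using assms(1) by (simp add: q_def)
  have exponents: "q \<le> a * i \<or> q \<le> a * j \<or> (a - 2) * q \<le> a * (q - 1 - i - j)"
    if "i \<le> q - 1" "j \<le> q - 1 - i" for i j
  proof (rule ccontr)
    assume "\<not> ?thesis"
    then have less: "a * i < q" "a * j < q" "a * (q - 1 - i - j) < (a - 2) * q" by auto
    have "a * i < a * c" "a * j < a * c" using less(1,2) q by linarith+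
    then have "i + 1 \<le> c" "j + 1 \<le> c" by simp_all
    then have "i + j + 2 \<le> 2 * c" by simp
    then have "a * (i + j + 2) \<le> 2 * (a * c)" by (metis mult.left_commute mult_le_mono2)
    moreover define k where "k = q - 1 - i - j"
    have "q = 1 + i + j + k" unfolding k_def using that less(1) by linarith
    then have "a * q = a * k + a * (i + j + 2) - a" by (simp add: algebra_simps)
    moreover have "a * k + 2 * q + 1 \<le> a * q"
    proof -
      obtain b where b: "a = b + 2" using assms(2) by (metis add.commute le_Suc_ex)
      with less(3) show ?thesis by (simp add: k_def algebra_simps)
    qed
    ultimately show False using q assms(2) by linarith
  qed
  have "fermat_series a ^ (q - 1) \<in> frob_power (z_axis_ideal (a - 2) :: 'p mod_ring fps3 set) e"
    unfolding fermat_series_power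
    by (intro is_ideal_sum is_ideal_mult_left frob_power_is_ideal
        monomial_mem_frob_power_z_axis_ideal[OF q_def])
      (use exponents in \<open>simp del: diff_diff_left\<close>)
  then show ?thesis
    by (simp add: power_root_subset_iff is_ideal_z_axis_ideal q_def)
qed

theorem proposition6p3:
  fixes n a p :: nat
    and f :: "'p::prime_card mod_ring fps3"
  assumes "n > 0"
    and "a = 2 ^ (n + 1) + 1"
    and "p = CARD('p)"
    and "[p = 2] (mod a)"
    and "f = var_x ^ a + var_y ^ a + var_z ^ a"
  shows "\<exists>l \<in> {1 - 1 / real p ^ n <.. 1 - 1 / real p ^ (n + 1)}.
           F_jumping_number (ideal_gen {f}) l"
proof -
  have f: "f = fermat_series a" using assms(5) by (simp add: fermat_series_def)
  have "prime p" using assms(3) by (simp add: prime_card)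
  then have "p \<ge> 2" by (rule prime_ge_2_nat)
  have "(2::nat) ^ 1 \<le> 2 ^ (n + 1)" by (intro power_increasing) simp_all
  then have "a \<ge> 3" using assms(2) by simp
  have "p mod a = 2" using assms(4) \<open>a \<ge> 3\<close> by (simp add: cong_def)
  then have d: "p = a * (p div a) + 2" by (metis mult_div_mod_eq)
  have "coprime a 2" using assms(2) by simp
  then have cop: "coprime a p" using cong_imp_coprime[OF cong_sym[OF assms(4)]] by (simp add: coprime_commute)
  \<comment> \<open>Modulo a, 2^(n+1) + 1 = a vanishes.\<close>
  have "[p ^ (n + 1) + 1 = 2 ^ (n + 1) + 1] (mod a)" by (intro cong_add cong_pow assms(4) cong_refl)
  then have "a dvd p ^ (n + 1) + 1" using assms(2) by (metis cong_dvd_iff dvd_refl)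
  then obtain c where c: "p ^ (n + 1) + 1 = a * c" by blast
  define \<alpha> \<beta> where "\<alpha> = 1 - 1 / real p ^ n" and "\<beta> = 1 - 1 / real p ^ (n + 1)"
  have as_fraction: "1 - 1 / real p ^ e = real (p ^ e - 1) / real (CARD('p) ^ e)" for e
    using \<open>p \<ge> 2\<close> by (simp add: assms(3) field_simps of_nat_diff)
  have test_chain_\<alpha>: "test_chain f \<alpha> e = power_root f (p ^ n - 1) n" if "e \<ge> n" for e
    unfolding \<alpha>_def as_fraction using that by (rule test_chain_of_nat_divide)
  have test_chain_\<beta>: "test_chain f \<beta> e = power_root f (p ^ (n + 1) - 1) (n + 1)" if "e \<ge> n + 1" for e
    unfolding \<beta>_def as_fraction using that by (rule test_chain_of_nat_divide)
  have stab: "\<exists>e0. \<forall>e\<ge>e0. test_chain f l e = test_chain f l e0" if "l \<le> \<beta>" for l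
  proof (rule test_chain_stabilizes)
    \<comment> \<open>At stage n + 1 every chain with l \<le> \<beta> already contains the root at
      \<beta>, above which there are finitely many ideals.\<close>
    have "power_root f (p ^ (n + 1) - 1) (n + 1) \<subseteq> test_chain f l (n + 1)"
      using test_chain_antimono[OF that, of f "n + 1"] test_chain_\<beta>[of "n + 1"] by simp
    then show "finite {K. is_ideal K \<and> test_chain f l (n + 1) \<subseteq> K}"
      using finite_ideals_containing_power_root_fermat_series[where ?'p='p and a=a and e="n+1"] cop
      unfolding f assms(3) by (auto elim!: finite_subset[rotated])
  qed
  have "1 / real p ^ (n + 1) \<le> 1 / real p ^ n"
    using \<open>p \<ge> 2\<close> by (intro divide_left_mono power_increasing) simp_all
  then have "\<alpha> \<le> \<beta>" by (simp add: \<alpha>_def \<beta>_def)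
  have "0 \<le> \<alpha>" unfolding \<alpha>_def as_fraction by simp
  have "test_ideal (ideal_gen {f}) \<alpha> = power_root f (p ^ n - 1) n"
    using test_chain_\<alpha> by (rule test_ideal_eqI)
  then have mem: "var_z ^ (a - 3) \<in> test_ideal (ideal_gen {f}) \<alpha>"
    using var_z_power_mem_power_root[OF cop[unfolded assms(3)] d[unfolded assms(3)] assms(2)]
    by (simp only: f assms(3))
  have "test_ideal (ideal_gen {f}) \<beta> = power_root f (p ^ (n + 1) - 1) (n + 1)"
    using test_chain_\<beta> by (rule test_ideal_eqI)
  also have "\<dots> \<subseteq> z_axis_ideal (a - 2)"
    using power_root_subset_z_axis_ideal[where ?'p='p and a=a and e="n+1"] c \<open>a \<ge> 3\<close>
    by (simp add: f assms(3))
  finally have not_mem: "var_z ^ (a - 3) \<notin> test_ideal (ideal_gen {f}) \<beta>"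
    using monomial_mem_z_axis_ideal[where i=0 and j=0 and k="a - 3" and m="a - 2"] \<open>a \<ge> 3\<close> by auto
  \<comment> \<open>The power p^a serves only to exceed a: then the coordinate at x^a picks the
    coefficient 1 of x^a from f and kills the other two terms.\<close>
  define q where "q = CARD('p) ^ a"
  have "a < q" unfolding q_def using \<open>p \<ge> 2\<close> assms(3)
    by (metis less_exp order_less_le_trans power_mono zero_le)
  let ?\<theta> = "cartier3 q a 0 0 :: 'p mod_ring fps3 \<Rightarrow> _"
  have \<theta>: "cartier q ?\<theta>" using \<open>a < q\<close> by (intro cartier_cartier3[where e=a]) (simp_all add: q_def)
  have "?\<theta> (var_x ^ a) = 1" "?\<theta> (var_y ^ a) = 0" "?\<theta> (var_z ^ a) = 0"
    using cartier3_monomial[of a q 0 0 a 0 0] cartier3_monomial[of a q 0 0 0 a 0]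
      cartier3_monomial[of a q 0 0 0 0 a] \<open>a < q\<close> \<open>a \<ge> 3\<close> by simp_all
  then have "?\<theta> f = 1" by (simp add: assms(5) cartier_add[OF \<theta>])
  with \<theta> show ?thesis
    using F_jumping_number_between[OF stab _ _ \<open>0 \<le> \<alpha>\<close> \<open>\<alpha> \<le> \<beta>\<close> mem not_mem]
    unfolding \<alpha>_def \<beta>_def q_def by blast
qed

end
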